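(* Let $S=\{i_1,i_2,\dots,i_s\}$ be admissible. Then $\#\widehat{P}(S,n)$ is even if and only if there exists $i_j\in S$ such that $i_j$ is even.
   Context: $S_n$ is the set of permutations $\pi=\pi_1\cdots\pi_n$ of $\{1,\dots,n\}$. Set $\pi_0=0$. An index $i\in\{1,\dots,n-1\}$ is a peak of $\pi$ if $\pi_{i-1}<\pi_i>\pi_{i+1}$. $\widehat{P}(S,n)$ is the set of $\pi\in S_n$ whose peak set (in this sense) equals $S$. $S$ is $n$-admissible if $\widehat{P}(S,n)\ne\emptyset$; "admissible" means the statement is asserted for every $n$ for which $S$ is $n$-admissible. *)

theory Defs
  imports "HOL-Combinatorics.Permutations"
begin

text \<open>
  A permutation \<open>p\<close> of \<open>{1..n}\<close> is a function with \<open>p permutes {1..n}\<close>; it is the identity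
  outside \<open>{1..n}\<close>, so the convention \<open>p 0 = 0\<close> holds automatically. Hence
  \<open>1\<close> is a peak iff \<open>n > 1\<close> and \<open>p 1 > p 2\<close>. As \<open>p n\<close> is followed by
  no further entry, the index \<open>n\<close> is never a peak.
\<close>

definition peak_set :: "nat \<Rightarrow> (nat \<Rightarrow> nat) \<Rightarrow> nat set" where
  "peak_set n p = {i \<in> {1..<n}. p (i - 1) < p i \<and> p i > p (i + 1)}"

definition P_hat :: "nat set \<Rightarrow> nat \<Rightarrow> (nat \<Rightarrow> nat) set" where
  "P_hat S n = {p. p permutes {1..n} \<and> peak_set n p = S}"

definition admissible :: "nat \<Rightarrow> nat set \<Rightarrow> bool" where
  "admissible n S \<longleftrightarrow> P_hat S n \<noteq> {}"

end

theory Submission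
  imports Defs
begin

text \<open>
  Let \<open>m\<close> be the largest element of \<open>S\<close> and \<open>A = S - {m}\<close>. The permutations with no peak in
  \<open>{m<..<n}\<close> and with peak set \<open>A\<close> below \<open>m - 1\<close> have peak set \<open>A\<close>, \<open>A \<union> {m - 1}\<close> or \<open>S\<close>. Reversing
  the block of positions \<open>m, \<dots>, n\<close> is a fixed-point-free involution on them, so modulo 2 the count
  for \<open>S\<close> is the sum of the counts for \<open>A\<close> and \<open>A \<union> {m - 1}\<close>; induction on \<open>m\<close> does the rest.
\<close>

definition reverse_block :: "nat \<Rightarrow> nat \<Rightarrow> nat \<Rightarrow> nat" where
  "reverse_block m n i = (if m \<le> i \<and> i \<le> n then m + n - i else i)"

lemma reverse_block_involution [simp]: "reverse_block m n (reverse_block m n i) = i"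
  by (auto simp: reverse_block_def)

lemma reverse_block_permutes:
  assumes "1 \<le> m"
  shows "reverse_block m n permutes {1..n}"
proof (rule bij_imp_permutes)
  show "bij_betw (reverse_block m n) {1..n} {1..n}"
    by (rule bij_betw_byWitness[where f' = "reverse_block m n"])
       (use assms in \<open>auto simp: reverse_block_def\<close>)
qed (use assms in \<open>auto simp: reverse_block_def\<close>)

lemma finite_P_hat: "finite (P_hat S n)"
  unfolding P_hat_def by (rule finite_subset[OF _ finite_permutations[of "{1..n}"]]) auto

lemma P_hat_disjoint: "S \<noteq> T \<Longrightarrow> P_hat S n \<inter> P_hat T n = {}"
  by (auto simp: P_hat_def)

text \<open>Since \<open>f\<close> swaps the values of \<open>a\<close> and \<open>b\<close>, it
  matches the elements with \<open>a p < b p\<close> to those with \<open>b p < a p\<close>. As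
  \<open>a p\<close> and \<open>b p\<close> never agree, these two halves of equal size exhaust
  \<open>T\<close>.\<close>

lemma even_card_involution:
  fixes a b :: "'a \<Rightarrow> 'b::linorder"
  assumes "finite T"
    and "\<And>p. p \<in> T \<Longrightarrow> f p \<in> T" "\<And>p. p \<in> T \<Longrightarrow> f (f p) = p"
    and "\<And>p. p \<in> T \<Longrightarrow> a p \<noteq> b p"
    and "\<And>p. p \<in> T \<Longrightarrow> a (f p) = b p" "\<And>p. p \<in> T \<Longrightarrow> b (f p) = a p"
  shows "even (card T)"
proof -
  let ?L = "{p \<in> T. a p < b p}" and ?R = "{p \<in> T. b p < a p}"
  have "bij_betw f ?L ?R"
    by (rule bij_betw_byWitness[where f' = f]) (use assms in auto)
  then have "card ?L = card ?R"
    by (rule bij_betw_same_card)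
  moreover have "card (?L \<union> ?R) = card ?L + card ?R"
    by (rule card_Un_disjoint) (use assms(1) in auto)
  moreover have "?L \<union> ?R = T"
    using assms(4) by (auto simp: neq_iff)
  ultimately show ?thesis
    by simp
qed

text \<open>Ignoring the indices \<open>m - 1\<close> and \<open>m\<close> decouples the two blocks:
  the first condition reads \<open>p\<close> only at positions up to \<open>m - 1\<close>, the
  second only at positions from \<open>m\<close> to \<open>n\<close>. Hence the second block can be
  rearranged without disturbing the first condition.\<close>

lemma peak_set_minus_eq_iff:
  assumes "A \<subseteq> {1..<m - 1}" "m < n"
  shows "peak_set n p - {m - 1, m} = A \<longleftrightarrow>
    (\<forall>i. 1 \<le> i \<and> i < m - 1 \<longrightarrow> (i \<in> A \<longleftrightarrow> p (i - 1) < p i \<and> p (i + 1) < p i)) \<and>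
    (\<forall>i. m < i \<and> i < n \<longrightarrow> \<not> (p (i - 1) < p i \<and> p (i + 1) < p i))"
    (is "?lhs \<longleftrightarrow> ?low \<and> ?high")
proof -
  have A: "1 \<le> i \<and> i < m - 1" if "i \<in> A" for i
    using assms(1) that by auto
  show ?thesis
  proof
    assume ?lhs
    have "i \<in> A \<longleftrightarrow> p (i - 1) < p i \<and> p (i + 1) < p i" if "1 \<le> i" "i < m - 1" for i
      using that assms(2) by (auto simp flip: \<open>?lhs\<close> simp: peak_set_def)
    moreover have "\<not> (p (i - 1) < p i \<and> p (i + 1) < p i)" if "m < i" "i < n" for i
    proof
      assume "p (i - 1) < p i \<and> p (i + 1) < p i"
      then have "i \<in> peak_set n p - {m - 1, m}"
        using that by (auto simp: peak_set_def)
      then have "i \<in> A"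
        unfolding \<open>?lhs\<close> .
      then show False
        using A[of i] that by linarith
    qed
    ultimately show "?low \<and> ?high" by blast
  next
    assume *: "?low \<and> ?high"
    show ?lhs
    proof (rule set_eqI)
      fix i
      consider "i = 0" | "1 \<le> i" "i < m - 1" | "i = m - 1 \<or> i = m" | "m < i"
        by linarith
      then show "i \<in> peak_set n p - {m - 1, m} \<longleftrightarrow> i \<in> A"
      proof cases
        case 2
        then have "i \<in> A \<longleftrightarrow> p (i - 1) < p i \<and> p (i + 1) < p i"
          using * by blast
        then show ?thesis
          using 2 assms(2) by (auto simp: peak_set_def)
      next
        case 4
        then have "i \<notin> peak_set n p"
          using * by (auto simp: peak_set_def)
        then show ?thesis
          using 4 A[of i] by auto
      next
        case 3
        then show ?thesis
          using A[of i] by auto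
      qed (use A[of i] in \<open>auto simp: peak_set_def\<close>)
    qed
  qed
qed

lemma even_card_peak_set_minus:
  assumes "A \<subseteq> {1..<m - 1}" "1 \<le> m" "m < n"
  shows "even (card {p. p permutes {1..n} \<and> peak_set n p - {m - 1, m} = A})"
proof (rule even_card_involution[where f = "\<lambda>p. p \<circ> reverse_block m n"
      and a = "\<lambda>p. p m" and b = "\<lambda>p. p n"])
  show "finite {p. p permutes {1..n} \<and> peak_set n p - {m - 1, m} = A}"
    by (rule finite_subset[OF _ finite_permutations[of "{1..n}"]]) auto
next
  fix p assume "p \<in> {p. p permutes {1..n} \<and> peak_set n p - {m - 1, m} = A}"
  then have p: "p permutes {1..n}" and
    low: "\<And>i. 1 \<le> i \<Longrightarrow> i < m - 1 \<Longrightarrow> i \<in> A \<longleftrightarrow> p (i - 1) < p i \<and> p (i + 1) < p i" and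
    high: "\<And>i. m < i \<Longrightarrow> i < n \<Longrightarrow> \<not> (p (i - 1) < p i \<and> p (i + 1) < p i)"
    unfolding mem_Collect_eq peak_set_minus_eq_iff[OF assms(1,3)] by blast+
  let ?q = "p \<circ> reverse_block m n"
  have "?q permutes {1..n}"
    using permutes_compose[OF reverse_block_permutes[OF assms(2)] p] .
  moreover have "i \<in> A \<longleftrightarrow> ?q (i - 1) < ?q i \<and> ?q (i + 1) < ?q i" if "1 \<le> i" "i < m - 1" for i
  proof -
    have "?q (i - 1) = p (i - 1)" "?q i = p i" "?q (i + 1) = p (i + 1)"
      using that by (auto simp: reverse_block_def)
    then show ?thesis
      using low[OF that] by simp
  qed
  moreover have "\<not> (?q (i - 1) < ?q i \<and> ?q (i + 1) < ?q i)" if "m < i" "i < n" for i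
  proof -
    \<comment> \<open>Reversal sends an interior position of the block to an interior one and
      exchanges its two neighbours; the peak condition is symmetric in these.\<close>
    have "?q (i - 1) = p (m + n - i + 1)" "?q i = p (m + n - i)" "?q (i + 1) = p (m + n - i - 1)"
      using that by (auto simp: reverse_block_def intro!: arg_cong[of _ _ p])
    moreover have "m < m + n - i" "m + n - i < n"
      using that by linarith+
    ultimately show ?thesis
      using high[of "m + n - i"] by metis
  qed
  ultimately show "?q \<in> {p. p permutes {1..n} \<and> peak_set n p - {m - 1, m} = A}"
    unfolding mem_Collect_eq peak_set_minus_eq_iff[OF assms(1,3)] by blast
  \<comment> \<open>The involution swaps the values at the two ends of the block, which differ
    because \<open>m < n\<close>.\<close>
  show "p m \<noteq> p n"
    using permutes_inj[OF p] assms(3) by (auto dest: injD)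
  show "?q \<circ> reverse_block m n = p" "?q m = p n" "?q n = p m"
    using assms(3) by (simp_all add: fun_eq_iff, simp_all add: reverse_block_def)
qed

lemma even_card_P_hat_recurrence:
  assumes "A \<subseteq> {1..<m - 1}" "1 \<le> m" "m < n"
  shows "even (card (P_hat (insert m A) n) + card (P_hat A n) + card (P_hat (insert (m - 1) A) n))"
proof -
  have notin: "m \<notin> A" "m - 1 \<notin> A" "m \<noteq> m - 1"
    using assms by auto
  \<comment> \<open>Two consecutive indices cannot both be peaks, so only three of the four ways to
    put back \<open>m - 1\<close> and \<open>m\<close> remain. For \<open>m = 1\<close> the index
    \<open>m - 1\<close> is 0, which is never a peak.\<close>
  have "m - 1 \<notin> peak_set n p \<or> m \<notin> peak_set n p" for p
    using assms(2) by (auto simp: peak_set_def)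
  then have "peak_set n p - {m - 1, m} = A \<longleftrightarrow>
      peak_set n p = insert m A \<or> peak_set n p = A \<or> peak_set n p = insert (m - 1) A" for p
    using notin by blast
  then have "{p. p permutes {1..n} \<and> peak_set n p - {m - 1, m} = A} =
      (P_hat (insert m A) n \<union> P_hat A n) \<union> P_hat (insert (m - 1) A) n"
    by (auto simp: P_hat_def)
  moreover have "card ((P_hat (insert m A) n \<union> P_hat A n) \<union> P_hat (insert (m - 1) A) n) =
      card (P_hat (insert m A) n) + card (P_hat A n) + card (P_hat (insert (m - 1) A) n)"
  proof -
    have "insert m A \<noteq> A" "insert m A \<noteq> insert (m - 1) A" "A \<noteq> insert (m - 1) A"
      using notin by blast+
    then show ?thesis
      by (simp add: card_Un_disjoint finite_P_hat P_hat_disjoint Int_Un_distrib2)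
  qed
  ultimately show ?thesis
    using even_card_peak_set_minus[OF assms] by simp
qed

lemma P_hat_nonempty_imp:
  assumes "P_hat S n \<noteq> {}"
  shows "S \<subseteq> {1..<n}" "\<forall>i\<in>S. Suc i \<notin> S"
  using assms by (auto simp: P_hat_def peak_set_def)

lemma peak_set_id: "peak_set n id = {}"
  by (auto simp: peak_set_def)

text \<open>The convention \<open>p 0 = 0\<close> forces an ascent at the start, and without peaks
  each ascent forces the next. So \<open>p\<close> is increasing, and the base case of the induction
  has the odd count 1.\<close>

lemma P_hat_empty: "P_hat {} n = {id}"
proof -
  have "p = id" if p: "p permutes {1..n}" and no_peak: "peak_set n p = {}" for p
  proof -
    have p0: "p 0 = 0"
      using permutes_not_in[OF p] by simp
    have inj: "p i = p j \<longleftrightarrow> i = j" for i j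
      using permutes_inj[OF p] by (auto dest: injD)
    have ascent: "p i < p (Suc i)" if "i < n" for i
      using that
    proof (induction i)
      case 0
      then show ?case
        using inj[of "Suc 0" 0] p0 by simp
    next
      case (Suc i)
      then have "Suc i \<notin> peak_set n p" "p i < p (Suc i)"
        using no_peak by auto
      then show ?case
        using Suc.prems inj[of "Suc i" "Suc (Suc i)"] by (auto simp: peak_set_def)
    qed
    have "i \<le> p i" if "i \<le> n" for i
      using that
    proof (induction i)
      case (Suc i)
      then show ?case using ascent[of i] by simp
    qed simp
    then have "\<forall>i\<in>{1..n}. i \<le> p i" by simp
    then show ?thesis
      using permutes_natset_ge[OF p] by blast
  qed
  then show ?thesis
    by (auto simp: P_hat_def peak_set_id permutes_id)
qed

text \<open>Admissibility is replaced by the two conditions from \<open>P_hat_nonempty_imp\<close>,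
  which can be checked directly for the smaller sets of the induction.\<close>

lemma even_card_P_hat_iff:
  assumes "S \<subseteq> {1..<n}" "\<forall>i\<in>S. Suc i \<notin> S"
  shows "even (card (P_hat S n)) \<longleftrightarrow> (\<exists>i\<in>S. even i)"
  using assms
\<comment> \<open>Inserting 0 gives the empty set the measure 0, which is below every possible
  \<open>m\<close>.\<close>
proof (induction "Max (insert 0 S)" arbitrary: S rule: less_induct)
  case less
  show ?case
  proof (cases "S = {}")
    case True
    then show ?thesis by (simp add: P_hat_empty)
  next
    case False
    have fin: "finite S"
      using less.prems(1) finite_subset by blast
    define m where "m = Max S"
    define A where "A = S - {m}"
    have m: "m \<in> S" and le_m: "\<And>i. i \<in> S \<Longrightarrow> i \<le> m"
      using fin False by (auto simp: m_def)
    have bounds: "1 \<le> m" "m < n" and S: "S = insert m A"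
      using m less.prems(1) by (auto simp: A_def)
    have pred: "m - 1 \<notin> S"
      using less.prems(2) m bounds(1) by (metis Suc_diff_1 less_eq_Suc_le One_nat_def)
    have A: "A \<subseteq> {1..<m - 1}"
    proof
      fix i assume "i \<in> A"
      then have "i \<in> S" "i \<noteq> m" "i \<noteq> m - 1"
        using pred by (auto simp: A_def)
      then show "i \<in> {1..<m - 1}"
        using le_m[of i] less.prems(1) by auto
    qed
    have A_bounds: "1 \<le> i" "i < m - 1" if "i \<in> A" for i
      using that A by auto
    have max_S: "Max (insert 0 S) = m"
      using fin False by (simp add: m_def)
    have smaller: "Max (insert 0 B) < Max (insert 0 S)" if "B \<subseteq> {..<m}" for B
      unfolding max_S using that bounds(1) finite_subset[OF that] by (subst Max_less_iff) auto
    have IH_A: "even (card (P_hat A n)) \<longleftrightarrow> (\<exists>i\<in>A. even i)"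
    proof (rule less.hyps[OF smaller])
      show "A \<subseteq> {..<m}"
        using A by fastforce
    qed (use less.prems in \<open>auto simp: A_def\<close>)
    have IH_pred: "even (card (P_hat (insert (m - 1) A) n)) \<longleftrightarrow> (\<exists>i\<in>insert (m - 1) A. even i)"
    \<comment> \<open>This asks whether \<open>insert (m - 1) A\<close> satisfies the hypotheses of
      the induction: its new element must be positive and must not follow an element of
      \<open>A\<close>.\<close>
    proof (cases "1 \<le> m - 1 \<and> m - 2 \<notin> A")
      case True
      have "Suc i \<notin> insert (m - 1) A" if "i \<in> insert (m - 1) A" for i
      proof (cases "i = m - 1")
        case i: True
        have "m \<notin> insert (m - 1) A"
          using bounds(1) by (auto simp: A_def)
        then show ?thesis
          using i bounds(1) by simp
      next
        case False
        then have "i \<in> A" using that by simp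
        then have "i \<in> S" by (simp add: A_def)
        then have "Suc i \<notin> A"
          using less.prems(2) by (simp add: A_def)
        moreover have "i \<noteq> m - 2"
          using \<open>i \<in> A\<close> True by blast
        then have "Suc i \<noteq> m - 1"
          by linarith
        ultimately show ?thesis by simp
      qed
      moreover have "insert (m - 1) A \<subseteq> {1..<n}" "insert (m - 1) A \<subseteq> {..<m}"
        using True A_bounds bounds by force+
      ultimately show ?thesis
        by (intro less.hyps[OF smaller] ballI)
    next
      \<comment> \<open>Here the count is 0, hence even, and the set does contain an even number:
        either 0 itself or one of the consecutive numbers \<open>m - 2\<close> and
        \<open>m - 1\<close>. So the equivalence survives outside the hypotheses of the
        induction.\<close>
      case False
      then consider "m = 1" | "m - 2 \<in> A" "2 \<le> m"
        using bounds(1) by linarith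
      then have "P_hat (insert (m - 1) A) n = {} \<and> (\<exists>i\<in>insert (m - 1) A. even i)"
      proof cases
        case 1
        then show ?thesis
          using P_hat_nonempty_imp(1)[of "insert (m - 1) A" n] by auto
      next
        case 2
        then have Suc: "Suc (m - 2) = m - 1" by simp
        then have "P_hat (insert (m - 1) A) n = {}"
          using 2(1) P_hat_nonempty_imp(2)[of "insert (m - 1) A" n] by auto
        moreover have "even (m - 2) \<or> even (m - 1)"
          using Suc by (metis even_Suc)
        ultimately show ?thesis
          using 2(1) by blast
      qed
      then show ?thesis by simp
    qed
    have "even (card (P_hat S n)) \<longleftrightarrow>
        even (card (P_hat A n)) = even (card (P_hat (insert (m - 1) A) n))"
      using even_card_P_hat_recurrence[OF A bounds] unfolding S even_add by argo
    \<comment> \<open>If \<open>A\<close> has an even element, both counts are even. Otherwise the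
      count for \<open>A\<close> is odd, and the other count is odd exactly when
      \<open>m - 1\<close> is odd, that is, when \<open>m\<close> is even.\<close>
    also have "\<dots> \<longleftrightarrow> (\<exists>i\<in>S. even i)"
      using bounds(1) unfolding IH_A IH_pred S by auto
    finally show ?thesis .
  qed
qed

theorem theorem4p17:
  fixes S :: "nat set" and n :: nat
  assumes "admissible n S"
  shows "even (card (P_hat S n)) \<longleftrightarrow> (\<exists>i\<in>S. even i)"
  using even_card_P_hat_iff[OF P_hat_nonempty_imp] assms by (simp add: admissible_def)

end
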